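(* There exist six different pairs of geometric 2-dimensional projective-planar polyhedra in $\mathbb{R}^4$, all having the same 1-skeleton in $\mathbb{R}^4$, such that in each pair the two polyhedra have no face in common.
   Context: A geometric 2-dimensional projective-planar polyhedron in $\mathbb{R}^4$ is a geometric realization in $\mathbb{R}^4$ of a triangulation of the (real) projective plane. Here a triangulation of the projective plane is an abstract 2-dimensional simplicial complex whose underlying space is homeomorphic to the projective plane; its faces are its 2-simplices. A geometric realization of it in $\mathbb{R}^4$ represents vertices by points and every simplex by the (nondegenerate) convex hull of its vertices, without self-intersections: any two such geometric simplices intersect exactly in the geometric simplex spanned by their common vertices (or are disjoint if they have no common vertex). The 1-skeleton of such a polyhedron is its set of vertices (points of $\mathbb{R}^4$) and edges (straight segments in $\mathbb{R}^4$). A face is one of the geometric triangles of the polyhedron, and two polyhedra have a common face if some triangle is a face of both. *)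

theory Defs
  imports "HOL-Analysis.Analysis"
begin

text \<open>The points are the antipodal pairs of the unit 2-sphere, with the quotient topology.
  The lemma \<open>quotient_map_projective_plane\<close> confirms that the open sets below form a topology
  and that it is the quotient topology.\<close>

definition antipodal_class :: "real^3 \<Rightarrow> (real^3) set" where
  "antipodal_class x = {x, - x}"

definition projective_plane :: "(real^3) set topology" where
  "projective_plane = topology (\<lambda>U. U \<subseteq> antipodal_class ` sphere 0 1 \<and>
     openin (top_of_set (sphere 0 1)) {x \<in> sphere 0 1. antipodal_class x \<in> U})"

lemma openin_projective_plane:
  "openin projective_plane U \<longleftrightarrow> U \<subseteq> antipodal_class ` sphere 0 1 \<and>
     openin (top_of_set (sphere 0 1)) {x \<in> sphere 0 1. antipodal_class x \<in> U}"
proof -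
  have "istopology (\<lambda>U. U \<subseteq> antipodal_class ` sphere 0 1 \<and>
     openin (top_of_set (sphere 0 1)) {x \<in> sphere 0 1. antipodal_class x \<in> U})" (is "istopology ?L")
    unfolding istopology_def
  proof (intro conjI allI impI)
    fix S T
    assume S: "?L S" and T: "?L T"
    have "{x \<in> sphere 0 1. antipodal_class x \<in> S \<inter> T}
        = {x \<in> sphere 0 1. antipodal_class x \<in> S} \<inter> {x \<in> sphere 0 1. antipodal_class x \<in> T}"
      by auto
    then show "openin (top_of_set (sphere 0 1)) {x \<in> sphere 0 1. antipodal_class x \<in> S \<inter> T}"
      using S T by (simp only: openin_Int)
    show "S \<inter> T \<subseteq> antipodal_class ` sphere 0 1"
      using S by blast
  next
    fix \<K>
    assume K: "\<forall>K\<in>\<K>. ?L K"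
    have "{x \<in> sphere 0 1. antipodal_class x \<in> \<Union>\<K>}
        = (\<Union>K\<in>\<K>. {x \<in> sphere 0 1. antipodal_class x \<in> K})"
      by auto
    moreover have "openin (top_of_set (sphere 0 1))
        (\<Union>K\<in>\<K>. {x \<in> sphere 0 1. antipodal_class x \<in> K})"
      using K by (intro openin_Union) blast
    ultimately show "openin (top_of_set (sphere 0 1)) {x \<in> sphere 0 1. antipodal_class x \<in> \<Union>\<K>}"
      by simp
    show "\<Union>\<K> \<subseteq> antipodal_class ` sphere 0 1"
      using K by blast
  qed
  then show ?thesis
    unfolding projective_plane_def by (simp add: topology_inverse')
qed

lemma topspace_projective_plane: "topspace projective_plane = antipodal_class ` sphere 0 1"
proof -
  have *: "{x \<in> sphere 0 1. antipodal_class x \<in> antipodal_class ` sphere 0 1} = sphere 0 1"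
    by auto
  have "openin projective_plane (antipodal_class ` sphere 0 1)"
    unfolding openin_projective_plane * by simp
  then show ?thesis
    by (metis openin_projective_plane openin_subset openin_topspace subset_antisym)
qed

lemma quotient_map_projective_plane:
  "quotient_map (top_of_set (sphere 0 1)) projective_plane antipodal_class"
  unfolding quotient_map_def topspace_projective_plane openin_projective_plane by auto

definition abstract_simplicial_complex :: "'a set set \<Rightarrow> bool" where
  "abstract_simplicial_complex K \<longleftrightarrow>
     finite K \<and> {} \<notin> K \<and> (\<forall>s\<in>K. finite s) \<and> (\<forall>s\<in>K. \<forall>t. t \<subseteq> s \<and> t \<noteq> {} \<longrightarrow> t \<in> K)"

definition two_dimensional :: "'a set set \<Rightarrow> bool" where
  "two_dimensional K \<longleftrightarrow> (\<forall>s\<in>K. card s \<le> 3) \<and> (\<exists>s\<in>K. card s = 3)"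

text \<open>Points are given by their barycentric coordinates. Below, the topology is that of pointwise
  convergence, which is the usual one as the complex is finite.\<close>

definition underlying_space :: "'a set set \<Rightarrow> ('a \<Rightarrow> real) set" where
  "underlying_space K =
     {x. (\<forall>v. 0 \<le> x v) \<and> {v. x v \<noteq> 0} \<in> K \<and> (\<Sum>v | x v \<noteq> 0. x v) = 1}"

definition triangulation_of_projective_plane :: "'a set set \<Rightarrow> bool" where
  "triangulation_of_projective_plane K \<longleftrightarrow>
     abstract_simplicial_complex K \<and> two_dimensional K \<and>
     top_of_set (underlying_space K) homeomorphic_space projective_plane"

text \<open>For \<open>s \<inter> t = {}\<close> the last condition says that the two geometric simplices are disjoint.\<close>

definition geometric_realization :: "'a set set \<Rightarrow> ('a \<Rightarrow> 'n::euclidean_space) \<Rightarrow> bool" where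
  "geometric_realization K f \<longleftrightarrow>
     inj_on f (\<Union>K) \<and>
     (\<forall>s\<in>K. \<not> affine_dependent (f ` s)) \<and>
     (\<forall>s\<in>K. \<forall>t\<in>K. convex hull (f ` s) \<inter> convex hull (f ` t) = convex hull (f ` (s \<inter> t)))"

text \<open>A polyhedron is the set of its geometric simplices. As a triangulation is finite, taking the
  abstract vertices to be natural numbers is no restriction.\<close>

definition projective_planar_polyhedron :: "(real^4) set set \<Rightarrow> bool" where
  "projective_planar_polyhedron P \<longleftrightarrow>
     (\<exists>(K :: nat set set) f. triangulation_of_projective_plane K \<and> geometric_realization K f \<and>
        P = (\<lambda>s. convex hull (f ` s)) ` K)"

definition vertices :: "(real^4) set set \<Rightarrow> (real^4) set" where
  "vertices P = {v. {v} \<in> P}"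

definition edges :: "(real^4) set set \<Rightarrow> (real^4) set set" where
  "edges P = {e \<in> P. 1 simplex e}"

definition faces :: "(real^4) set set \<Rightarrow> (real^4) set set" where
  "faces P = {T \<in> P. 2 simplex T}"

definition one_skeleton :: "(real^4) set set \<Rightarrow> (real^4) set \<times> (real^4) set set" where
  "one_skeleton P = (vertices P, edges P)"

end

theory Submission
  imports Defs
begin

text \<open>The six-vertex triangulation of the projective plane is the icosahedron modulo the antipodal
  map. It contains all 15 edges on its vertices and exactly one of every two complementary vertex
  triples. Label the vertices so that the link of 0 is the pentagon 1, 2, 3, 4, 5; the triangles are
  then \<open>{0, i, i + 1}\<close> and \<open>{i, i + 1, i + 3}\<close>, with the nonzero labels read modulo 5. Replacing the
  pentagon by the pentagram of its diagonals, that is, doubling the labels modulo 5, gives the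
  triangulation whose triangles are the ten triples left out. So every labelling has a partner with
  the same edges and no common triangle (\<open>pentagon_doubling_triangle\<close>). A pair is determined by a
  splitting of the complete graph on 1, ..., 5 into two pentagons. In each splitting exactly one
  pentagon contains the edge 1, 2, and the arrangements of 3, 4, 5 give all six of them.

  All these triangulations live on the same six points of four-space: the origin, the unit vectors
  and the negative of their sum. Up to scaling, their only affine dependence balances the five outer
  points against the origin, so a point in two of the simplices with at most three vertices must have
  the same barycentric coordinates in both: the two simplices meet in their common face
  (\<open>convex_hull_points_Int\<close>). Hence every labelling of the triangulation is geometrically realized,
  and the 1-skeleton is always the complete graph on the six points.

  That the abstract complex triangulates the projective plane is shown by an explicit piecewise linear
  map on the sphere. Six lines through the origin give twelve rays, which span a complete centrally
  symmetric fan with the combinatorics of the icosahedron. The coordinates of a vector with respect to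
  the fan, taken in absolute value and normalized to sum 1, are the barycentric coordinates of a point
  of the complex. This map is continuous, it is onto (\<open>underlying_space_subset_fan_barycentric\<close>), and
  its fibres are the antipodal pairs (\<open>fan_barycentric_eq_iff\<close>). As the sphere is compact, it is a
  quotient map.\<close>


section \<open>Recognizing the projective plane\<close>

text \<open>A quotient space is determined by the fibres of its quotient map, since each of the two maps
  factors continuously through the other.\<close>

lemma homeomorphic_space_of_quotient_maps:
  assumes f: "quotient_map X Y f" and g: "quotient_map X Z g"
    and fibres: "\<And>x y. \<lbrakk>x \<in> topspace X; y \<in> topspace X\<rbrakk> \<Longrightarrow> f x = f y \<longleftrightarrow> g x = g y"
  shows "Y homeomorphic_space Z"
proof -
  obtain h where h: "continuous_map Y Z h" "\<And>x. x \<in> topspace X \<Longrightarrow> h (f x) = g x"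
    using quotient_map_lift_exists[OF f quotient_imp_continuous_map[OF g]] fibres by metis
  obtain k where k: "continuous_map Z Y k" "\<And>x. x \<in> topspace X \<Longrightarrow> k (g x) = f x"
    using quotient_map_lift_exists[OF g quotient_imp_continuous_map[OF f]] fibres by metis
  have "k (h y) = y" if "y \<in> topspace Y" for y
    using that quotient_imp_surjective_map[OF f] h k by (metis imageE)
  moreover have "h (k z) = z" if "z \<in> topspace Z" for z
    using that quotient_imp_surjective_map[OF g] h k by (metis imageE)
  ultimately have "homeomorphic_maps Y Z h k"
    unfolding homeomorphic_maps_def using h(1) k(1) by blast
  then show ?thesis
    unfolding homeomorphic_space_def by blast
qed

text \<open>By compactness of the sphere, a continuous map to a Hausdorff space is closed, hence a quotient
  map onto its image.\<close>

lemma homeomorphic_space_projective_plane: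
  fixes g :: "real^3 \<Rightarrow> 'b::metric_space"
  assumes cont: "continuous_on (sphere 0 1) g"
    and fibres: "\<And>x y. \<lbrakk>x \<in> sphere 0 1; y \<in> sphere 0 1\<rbrakk> \<Longrightarrow> g x = g y \<longleftrightarrow> x = y \<or> x = - y"
  shows "top_of_set (g ` sphere 0 1) homeomorphic_space projective_plane"
proof (rule homeomorphic_space_of_quotient_maps)
  show "quotient_map (top_of_set (sphere 0 1)) (top_of_set (g ` sphere 0 1)) g"
  proof (rule T1_Spaces.continuous_imp_quotient_map)
    show "continuous_map (top_of_set (sphere 0 1)) (top_of_set (g ` sphere 0 1)) g"
      using cont by auto
    show "compact_space (top_of_set (sphere (0::real^3) 1))"
      by (simp add: compact_space_subtopology)
    show "Hausdorff_space (top_of_set (g ` sphere 0 1))"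
      by (intro Hausdorff_space_subtopology Hausdorff_space_euclidean)
  qed simp
  show "quotient_map (top_of_set (sphere 0 1)) projective_plane antipodal_class"
    by (rule quotient_map_projective_plane)
  show "g x = g y \<longleftrightarrow> antipodal_class x = antipodal_class y"
    if "x \<in> topspace (top_of_set (sphere 0 1))" "y \<in> topspace (top_of_set (sphere 0 1))" for x y
    using fibres[of x y] that by (auto simp: antipodal_class_def doubleton_eq_iff)
qed


section \<open>The fan over the icosahedron and its coordinates\<close>

text \<open>The rays are \<open>(0, \<plusminus>1, \<plusminus>1)\<close> and their cyclic shifts: the vertices of a cuboctahedron, whose square
  faces are split by diagonals into triangles so as to give a combinatorial icosahedron. On the fan
  over its faces, \<open>hat\<close> is the function that is linear on each cone, 2 on \<open>(0, 1, 1)\<close> and 0 on the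
  other rays. The value 2 rather than 1 keeps the formula free of fractions. The cyclic shifts
  and the sign changes of coordinates are symmetries of the fan, and they carry it to the corresponding
  functions of the other eleven rays.\<close>

definition hat :: "real \<Rightarrow> real \<Rightarrow> real \<Rightarrow> real" where
  "hat a b c = max 0 (min (2 * c) (b + c - \<bar>a\<bar>))"

text \<open>The functions of two opposite rays have disjoint supports, so their difference loses no
  information; its sign tells which of the two rays is involved.\<close>

definition signed_hat :: "real \<Rightarrow> real \<Rightarrow> real \<Rightarrow> real" where
  "signed_hat a b c = hat a b c - hat a (- b) (- c)"

lemma signed_hat_pos_iff: "signed_hat a b c > 0 \<longleftrightarrow> 0 < c \<and> \<bar>a\<bar> < b + c"
  unfolding signed_hat_def hat_def by (auto simp: max_def min_def)

lemma signed_hat_neg_iff: "signed_hat a b c < 0 \<longleftrightarrow> c < 0 \<and> \<bar>a\<bar> < - b - c"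
  unfolding signed_hat_def hat_def by (auto simp: max_def min_def)

lemma signed_hat_scale:
  assumes "t \<ge> 0"
  shows "signed_hat (t * a) (t * b) (t * c) = t * signed_hat a b c"
proof -
  have "hat (t * a) (t * b) (t * c) = t * hat a b c" for a b c
    using assms unfolding hat_def
    by (simp add: max_mult_distrib_left min_mult_distrib_left abs_mult algebra_simps)
  from this[of a b c] this[of a "- b" "- c"] show ?thesis
    by (simp add: signed_hat_def right_diff_distrib)
qed

text \<open>The identity is piecewise linear. On each cone the hat functions give twice the coefficients of a
  vector in terms of the rays of the cone, and \<open>x\<close> is linear.\<close>

lemma signed_hat_reproduces:
  "2 * x = signed_hat y z x + signed_hat z x y - signed_hat z (- x) y - signed_hat y z (- x)"
  unfolding signed_hat_def hat_def by (smt (verit))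

text \<open>One ray is chosen on each of the six lines. The rays 1, ..., 5 are the neighbours of the ray 0, in
  cyclic order.\<close>

definition fan_ray :: "nat \<Rightarrow> real^3" where
  "fan_ray i =
     (if i = 0 then vector [0, 1, 1] else if i = 1 then vector [0, - 1, 1]
      else if i = 2 then vector [1, 0, 1] else if i = 3 then vector [1, 1, 0]
      else if i = 4 then vector [- 1, 1, 0] else vector [- 1, 0, 1])"

definition fan_coord :: "real^3 \<Rightarrow> nat \<Rightarrow> real" where
  "fan_coord X i =
     (let x = X $ 1; y = X $ 2; z = X $ 3 in
      if i = 0 then signed_hat x y z else if i = 1 then signed_hat x (- y) z
      else if i = 2 then signed_hat y z x else if i = 3 then signed_hat z x y
      else if i = 4 then signed_hat z (- x) y else if i = 5 then signed_hat y z (- x)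
      else 0)"

lemma lessThan_6: "{..<6::nat} = {0, 1, 2, 3, 4, 5}"
  by auto

lemma fan_coord_eq_0: "i \<ge> 6 \<Longrightarrow> fan_coord X i = 0"
  by (simp add: fan_coord_def)

lemma fan_coord_scale:
  assumes "t \<ge> 0"
  shows "fan_coord (t *\<^sub>R X) i = t * fan_coord X i"
proof -
  note scale = signed_hat_scale[OF assms]
  have "signed_hat (t * a) (- (t * b)) (t * c) = t * signed_hat a (- b) c"
    and "signed_hat (t * a) (t * b) (- (t * c)) = t * signed_hat a b (- c)" for a b c
    using scale[of a "- b" c] scale[of a b "- c"] by simp_all
  with scale show ?thesis
    by (simp add: fan_coord_def Let_def)
qed

lemma fan_coord_minus: "fan_coord (- X) i = - fan_coord X i"
  by (simp add: fan_coord_def Let_def signed_hat_def hat_def)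

lemma continuous_on_signed_hat [continuous_intros]:
  assumes "continuous_on S f" "continuous_on S g" "continuous_on S h"
  shows "continuous_on S (\<lambda>X. signed_hat (f X) (g X) (h X))"
  unfolding signed_hat_def hat_def using assms by (intro continuous_intros)

lemma continuous_on_fan_coord: "continuous_on S (\<lambda>X. fan_coord X i)"
proof (cases "i < 6")
  case True
  then have "i \<in> {0, 1, 2, 3, 4, 5}"
    by auto
  then show ?thesis
    by (elim insertE emptyE) (simp_all add: fan_coord_def Let_def continuous_intros)
qed (simp add: fan_coord_eq_0)

lemma fan_coord_expansion: "(\<Sum>i<6. fan_coord X i *\<^sub>R fan_ray i) = 2 *\<^sub>R X"
  using signed_hat_reproduces[of "X $ 1" "X $ 2" "X $ 3"]
    signed_hat_reproduces[of "X $ 2" "X $ 3" "X $ 1"]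
    signed_hat_reproduces[of "X $ 3" "X $ 1" "X $ 2"]
  by (simp add: lessThan_6 vec_eq_iff forall_3 fan_coord_def fan_ray_def Let_def vector_3
      signed_hat_def)

text \<open>The cones of the fan modulo the antipodal map: \<open>(i, j, k, s)\<close> stands for the cone spanned by the
  rays \<open>i\<close> and \<open>j\<close> and by \<open>s\<close> times the ray \<open>k\<close>.\<close>

definition lifted_triangles :: "(nat \<times> nat \<times> nat \<times> real) set" where
  "lifted_triangles = {(0,1,2,1), (0,2,3,1), (0,3,4,1), (0,4,5,1), (0,5,1,1),
     (1,2,4,-1), (2,3,5,-1), (3,4,1,-1), (4,5,2,-1), (5,1,3,-1)}"

text \<open>Prescribed coefficients on a cone of the fan are recovered by the hat functions. This is where
  surjectivity of the map to the complex comes from.\<close>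

lemma fan_coord_on_cone:
  assumes "(i, j, k, s) \<in> lifted_triangles"
    and "p \<ge> 0" "q \<ge> 0" "r \<ge> 0"
  shows "fan_coord (p *\<^sub>R fan_ray i + q *\<^sub>R fan_ray j + (s * r) *\<^sub>R fan_ray k) l
    = 2 * (if l = i then p else if l = j then q else if l = k then s * r else 0)"
proof (cases "l < 6")
  case True
  then have "l \<in> {0,1,2,3,4,5}"
    by auto
  have ray:
   "fan_ray 0 $ 1 = 0" "fan_ray 0 $ 2 = 1" "fan_ray 0 $ 3 = 1"
   "fan_ray 1 $ 1 = 0" "fan_ray 1 $ 2 = -1" "fan_ray 1 $ 3 = 1"
   "fan_ray 2 $ 1 = 1" "fan_ray 2 $ 2 = 0" "fan_ray 2 $ 3 = 1"
   "fan_ray 3 $ 1 = 1" "fan_ray 3 $ 2 = 1" "fan_ray 3 $ 3 = 0"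
   "fan_ray 4 $ 1 = -1" "fan_ray 4 $ 2 = 1" "fan_ray 4 $ 3 = 0"
   "fan_ray 5 $ 1 = -1" "fan_ray 5 $ 2 = 0" "fan_ray 5 $ 3 = 1"
    by (simp_all add: fan_ray_def vector_3)
  show ?thesis
    using assms \<open>l \<in> _\<close> unfolding lifted_triangles_def
    by (elim insertE emptyE Pair_inject;
        simp only: fan_coord_def Let_def vector_add_component vector_scaleR_component ray;
        simp add: signed_hat_def hat_def)
qed (use assms in \<open>auto simp: lifted_triangles_def fan_coord_eq_0\<close>)

text \<open>Two of the six lines span a unique two-dimensional cone of the fan up to the antipodal map. It
  contains both chosen rays, or one of them and the negative of the other. The second case occurs
  precisely for the diagonals of the pentagon around the ray 0. So the relative sign of two nonzero
  coordinates depends only on the indices.\<close>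

definition pentagon_diagonals :: "(nat \<times> nat) set" where
  "pentagon_diagonals =
     {(1,3), (2,4), (3,5), (4,1), (5,2), (3,1), (4,2), (5,3), (1,4), (2,5)}"

lemma fan_coord_mult_nonpos:
  "(i, j) \<in> pentagon_diagonals \<Longrightarrow> fan_coord X i * fan_coord X j \<le> 0"
  unfolding pentagon_diagonals_def not_less[symmetric] zero_less_mult_iff
  by (elim insertE emptyE Pair_inject; simp;
      auto simp: fan_coord_def Let_def signed_hat_pos_iff signed_hat_neg_iff)

lemma fan_coord_mult_nonneg:
  assumes "(i, j) \<notin> pentagon_diagonals"
  shows "0 \<le> fan_coord X i * fan_coord X j"
proof (cases "i < 6 \<and> j < 6")
  case True
  then have "i \<in> {0,1,2,3,4,5}" "j \<in> {0,1,2,3,4,5}"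
    by auto
  with assms consider "i = j" | "(i, j) \<in>
      {(0,1), (0,2), (0,3), (0,4), (0,5), (1,2), (2,3), (3,4), (4,5), (5,1),
       (1,0), (2,0), (3,0), (4,0), (5,0), (2,1), (3,2), (4,3), (5,4), (1,5)}"
    by (elim insertE emptyE) (simp_all add: pentagon_diagonals_def)
  then show ?thesis
  proof cases
    case 2
    then show ?thesis
      unfolding not_less[symmetric] mult_less_0_iff
      by (elim insertE emptyE Pair_inject; simp;
          auto simp: fan_coord_def Let_def signed_hat_pos_iff signed_hat_neg_iff)
  qed simp
qed (auto simp: fan_coord_eq_0)

lemma fan_coord_relative_sign:
  "0 \<le> (fan_coord X i * fan_coord X j) * (fan_coord Y i * fan_coord Y j)"
  by (cases "(i, j) \<in> pentagon_diagonals")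
    (simp_all add: fan_coord_mult_nonneg fan_coord_mult_nonpos mult_nonpos_nonpos)

text \<open>One sign, that of a nonzero coordinate, fixes all the others. So the absolute values of the
  coordinates determine the vector up to its sign, and to a positive factor.\<close>

lemma fan_coord_determines_up_to_sign:
  assumes X: "X \<in> sphere 0 1" and Y: "Y \<in> sphere 0 1" and t: "t > 0"
    and eq: "\<And>i. \<bar>fan_coord X i\<bar> = t * \<bar>fan_coord Y i\<bar>"
  shows "X = Y \<or> X = - Y"
proof -
  obtain i where i: "fan_coord X i \<noteq> 0"
    using fan_coord_expansion[of X] X by fastforce
  then have "fan_coord Y i \<noteq> 0"
    using eq[of i] by auto
  obtain e :: real where e: "e = 1 \<or> e = - 1" "0 < fan_coord X i * (e * fan_coord Y i)"
  proof (cases "0 < fan_coord X i * fan_coord Y i")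
    case True
    then show ?thesis
      using that[of 1] by simp
  next
    case False
    then show ?thesis
      using that[of "- 1"] i \<open>fan_coord Y i \<noteq> 0\<close> by (simp add: not_less order.strict_iff_order)
  qed
  have "fan_coord X j = t * (e * fan_coord Y j)" for j
  proof -
    have "0 \<le> (fan_coord X i * (e * fan_coord Y i)) * (fan_coord X j * (e * fan_coord Y j))"
      using fan_coord_relative_sign[of X i j Y] e(1) by (auto simp: ac_simps)
    then have "0 \<le> fan_coord X j * (e * fan_coord Y j)"
      using e(2) by (simp add: zero_le_mult_iff)
    moreover have "\<bar>fan_coord X j\<bar> = t * \<bar>e * fan_coord Y j\<bar>"
      using eq[of j] e(1) by (auto simp: abs_mult)
    moreover have "a = t * b" if "0 \<le> a * b" "\<bar>a\<bar> = t * \<bar>b\<bar>" for a b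
      using that t by (auto simp: zero_le_mult_iff abs_if split: if_splits)
    ultimately show ?thesis
      by blast
  qed
  then have "2 *\<^sub>R X = (\<Sum>j<6. (t * e) *\<^sub>R (fan_coord Y j *\<^sub>R fan_ray j))"
    by (simp flip: fan_coord_expansion add: mult.assoc)
  also have "\<dots> = (t * e) *\<^sub>R (2 *\<^sub>R Y)"
    by (simp only: fan_coord_expansion flip: scaleR_sum_right)
  finally have XY: "X = (t * e) *\<^sub>R Y"
    by (simp add: vec_eq_iff)
  then have "norm X = t * norm Y"
    using e(1) t by auto
  then have "t = 1"
    using X Y by simp
  with XY e(1) show ?thesis
    by auto
qed

section \<open>The six-vertex triangulation\<close>

definition rp2_triangles :: "nat set set" where
  "rp2_triangles = {{0,1,2}, {0,2,3}, {0,3,4}, {0,4,5}, {0,5,1},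
     {1,2,4}, {2,3,5}, {3,4,1}, {4,5,2}, {5,1,3}}"

definition rp2_complex :: "nat set set" where
  "rp2_complex = {s. s \<noteq> {} \<and> (\<exists>F\<in>rp2_triangles. s \<subseteq> F)}"

text \<open>The three pairwise products of three nonzero reals have a positive product, so the number of negative
  ones is even. Each of the ten triples that are not triangles contains exactly one diagonal of the
  pentagon, so one of its three coordinates is zero. A set of indices without such a triple lies in a
  triangle.\<close>

lemma fan_coord_support_subset_triangle:
  obtains F where "F \<in> rp2_triangles" "{i. fan_coord X i \<noteq> 0} \<subseteq> F"
proof -
  have zero: "a = 0 \<or> b = 0 \<or> c = 0" if "0 \<le> a * b" "0 \<le> b * c" "a * c \<le> 0" for a b c :: real
    using that by (auto simp: zero_le_mult_iff mult_le_0_iff)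
  let ?z = "\<lambda>i. fan_coord X i = 0"
  have "?z 1 \<or> ?z 0 \<or> ?z 3" "?z 2 \<or> ?z 0 \<or> ?z 4" "?z 3 \<or> ?z 0 \<or> ?z 5" "?z 4 \<or> ?z 0 \<or> ?z 1"
    "?z 5 \<or> ?z 0 \<or> ?z 2" "?z 1 \<or> ?z 2 \<or> ?z 3" "?z 2 \<or> ?z 3 \<or> ?z 4" "?z 3 \<or> ?z 4 \<or> ?z 5"
    "?z 4 \<or> ?z 5 \<or> ?z 1" "?z 5 \<or> ?z 1 \<or> ?z 2"
    by (intro zero fan_coord_mult_nonneg fan_coord_mult_nonpos; simp add: pentagon_diagonals_def)+
  moreover have "(\<exists>F\<in>rp2_triangles. \<forall>i\<in>{..<6} - F. ?z i) \<longleftrightarrow>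
      ?z 3 \<and> ?z 4 \<and> ?z 5 \<or> ?z 1 \<and> ?z 4 \<and> ?z 5 \<or> ?z 1 \<and> ?z 2 \<and> ?z 5 \<or> ?z 1 \<and> ?z 2 \<and> ?z 3 \<or>
      ?z 2 \<and> ?z 3 \<and> ?z 4 \<or> ?z 0 \<and> ?z 3 \<and> ?z 5 \<or> ?z 0 \<and> ?z 1 \<and> ?z 4 \<or> ?z 0 \<and> ?z 2 \<and> ?z 5 \<or>
      ?z 0 \<and> ?z 1 \<and> ?z 3 \<or> ?z 0 \<and> ?z 2 \<and> ?z 4"
    by (simp add: rp2_triangles_def lessThan_6 insert_Diff_if)
  ultimately have "\<exists>F\<in>rp2_triangles. \<forall>i\<in>{..<6} - F. ?z i"
    by argo
  then obtain F where F: "F \<in> rp2_triangles" "\<And>i. i < 6 \<Longrightarrow> i \<notin> F \<Longrightarrow> ?z i"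
    by (metis DiffI lessThan_iff)
  have "i \<in> F" if "\<not> ?z i" for i
    using F(2)[of i] that fan_coord_eq_0[of i X] by (cases "i < 6") auto
  then show ?thesis
    using that F(1) by blast
qed

definition fan_barycentric :: "real^3 \<Rightarrow> nat \<Rightarrow> real" where
  "fan_barycentric X i = \<bar>fan_coord X i\<bar> / (\<Sum>j<6. \<bar>fan_coord X j\<bar>)"

lemma fan_coord_nonzero:
  assumes "X \<noteq> 0"
  obtains i where "i < 6" "fan_coord X i \<noteq> 0"
proof -
  have "(\<Sum>i<6. fan_coord X i *\<^sub>R fan_ray i) \<noteq> 0"
    using assms by (simp add: fan_coord_expansion)
  then obtain i where "i < 6" "fan_coord X i *\<^sub>R fan_ray i \<noteq> 0"
    by (meson lessThan_iff sum.neutral)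
  then show ?thesis
    using that by auto
qed

lemma fan_coord_sum_pos: "X \<noteq> 0 \<Longrightarrow> 0 < (\<Sum>j<6. \<bar>fan_coord X j\<bar>)"
  by (metis fan_coord_nonzero abs_ge_zero finite_lessThan lessThan_iff sum_pos2 zero_less_abs_iff)

lemma fan_barycentric_eq_iff:
  assumes X: "X \<in> sphere 0 1" and Y: "Y \<in> sphere 0 1"
  shows "fan_barycentric X = fan_barycentric Y \<longleftrightarrow> X = Y \<or> X = - Y"
proof
  assume eq: "fan_barycentric X = fan_barycentric Y"
  have pos: "0 < (\<Sum>j<6. \<bar>fan_coord X j\<bar>)" "0 < (\<Sum>j<6. \<bar>fan_coord Y j\<bar>)"
    using X Y by (auto intro!: fan_coord_sum_pos)
  show "X = Y \<or> X = - Y"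
  proof (rule fan_coord_determines_up_to_sign[OF X Y])
    show "0 < (\<Sum>j<6. \<bar>fan_coord X j\<bar>) / (\<Sum>j<6. \<bar>fan_coord Y j\<bar>)"
      using pos by simp
    show "\<bar>fan_coord X i\<bar> =
        (\<Sum>j<6. \<bar>fan_coord X j\<bar>) / (\<Sum>j<6. \<bar>fan_coord Y j\<bar>) * \<bar>fan_coord Y i\<bar>" for i
      using fun_cong[OF eq, of i] pos by (simp add: fan_barycentric_def field_simps)
  qed
next
  assume "X = Y \<or> X = - Y"
  then show "fan_barycentric X = fan_barycentric Y"
    by (auto simp: fan_barycentric_def fan_coord_minus)
qed

lemma continuous_on_fan_barycentric: "continuous_on (sphere 0 1) fan_barycentric"
proof (rule continuous_on_coordinatewise_then_product)
  have "(\<Sum>j<6. \<bar>fan_coord X j\<bar>) \<noteq> 0" if "X \<in> sphere 0 1" for X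
    using fan_coord_sum_pos[of X] that by fastforce
  then show "continuous_on (sphere 0 1) (\<lambda>X. fan_barycentric X i)" for i
    unfolding fan_barycentric_def
    by (intro continuous_intros continuous_on_fan_coord) auto
qed

lemma fan_barycentric_in_underlying_space:
  assumes "X \<noteq> 0"
  shows "fan_barycentric X \<in> underlying_space rp2_complex"
proof -
  have pos: "0 < (\<Sum>j<6. \<bar>fan_coord X j\<bar>)"
    using fan_coord_sum_pos[OF assms] .
  then have supp: "{i. fan_barycentric X i \<noteq> 0} = {i. fan_coord X i \<noteq> 0}"
    by (auto simp: fan_barycentric_def)
  have "{i. fan_coord X i \<noteq> 0} \<in> rp2_complex"
  proof -
    obtain F where "F \<in> rp2_triangles" "{i. fan_coord X i \<noteq> 0} \<subseteq> F"
      using fan_coord_support_subset_triangle .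
    moreover obtain i where "fan_coord X i \<noteq> 0"
      using fan_coord_nonzero[OF assms] .
    ultimately show ?thesis
      by (auto simp: rp2_complex_def)
  qed
  moreover have "(\<Sum>i | fan_coord X i \<noteq> 0. fan_barycentric X i) = (\<Sum>i<6. fan_barycentric X i)"
    using fan_coord_eq_0[of _ X]
    by (intro sum.mono_neutral_left) (auto simp: fan_barycentric_def not_less[symmetric])
  moreover have "(\<Sum>i<6. fan_barycentric X i) = 1"
    using pos by (simp add: fan_barycentric_def flip: sum_divide_distrib)
  moreover have "0 \<le> fan_barycentric X i" for i
    using pos by (simp add: fan_barycentric_def)
  ultimately show ?thesis
    by (simp add: underlying_space_def supp)
qed

lemma underlying_space_subset_fan_barycentric:
  assumes w: "w \<in> underlying_space rp2_complex"
  obtains X where "X \<in> sphere 0 1" "fan_barycentric X = w"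
proof -
  have nonneg: "\<And>i. 0 \<le> w i" and supp: "{i. w i \<noteq> 0} \<in> rp2_complex"
    and sum: "(\<Sum>i | w i \<noteq> 0. w i) = 1"
    using w by (auto simp: underlying_space_def)
  obtain F where F: "F \<in> rp2_triangles" "{i. w i \<noteq> 0} \<subseteq> F"
    using supp by (auto simp: rp2_complex_def)
  have "F \<in> (\<lambda>(i, j, k, s). {i, j, k}) ` lifted_triangles"
    using F(1) by (simp add: rp2_triangles_def lifted_triangles_def)
  then obtain i j k s where ijk: "F = {i, j, k}" "(i, j, k, s) \<in> lifted_triangles"
    by auto
  have s: "\<bar>s\<bar> = 1"
    using ijk(2) unfolding lifted_triangles_def by (elim insertE emptyE) simp_all
  \<comment> \<open>The preimage lies on the cone over the triangle; only its length has to be adjusted.\<close>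
  define Z where "Z = w i *\<^sub>R fan_ray i + w j *\<^sub>R fan_ray j + (s * w k) *\<^sub>R fan_ray k"
  have Z: "\<bar>fan_coord Z l\<bar> = 2 * w l" for l
  proof -
    have "w l = 0" if "l \<notin> {i, j, k}"
      using that F(2) ijk(1) by auto
    then show ?thesis
      unfolding Z_def using fan_coord_on_cone[OF ijk(2) nonneg nonneg nonneg, of i j k l] nonneg s
      by (auto simp: abs_mult)
  qed
  have "w l = 0" if "l \<ge> 6" for l
    using Z[of l] that by (simp add: fan_coord_eq_0)
  then have sum6: "(\<Sum>l<6. w l) = 1"
    unfolding sum[symmetric] by (intro sum.mono_neutral_right) (auto simp flip: not_less)
  have "Z \<noteq> 0"
  proof
    assume "Z = 0"
    then have "w l = 0" for l
      using Z[of l] fan_coord_scale[of 0 0 l] by simp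
    with sum show False
      by simp
  qed
  define X where "X = (1 / norm Z) *\<^sub>R Z"
  have "\<bar>fan_coord X l\<bar> = (2 / norm Z) * w l" for l
    unfolding X_def using Z[of l] by (simp add: fan_coord_scale abs_mult)
  then have "fan_barycentric X = w"
    using sum6 \<open>Z \<noteq> 0\<close> by (simp add: fan_barycentric_def fun_eq_iff flip: sum_distrib_left sum_divide_distrib)
  moreover have "X \<in> sphere 0 1"
    using \<open>Z \<noteq> 0\<close> by (simp add: X_def)
  ultimately show ?thesis
    using that by blast
qed

lemma card_rp2_triangle: "F \<in> rp2_triangles \<Longrightarrow> card F = 3"
  by (auto simp: rp2_triangles_def)

lemma rp2_triangle_subset: "F \<in> rp2_triangles \<Longrightarrow> F \<subseteq> {..<6}"
  by (auto simp: rp2_triangles_def)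

lemma rp2_complexD:
  assumes "s \<in> rp2_complex"
  shows "s \<noteq> {}" "s \<subseteq> {..<6}" "card s \<le> 3"
proof -
  obtain F where F: "F \<in> rp2_triangles" "s \<subseteq> F"
    using assms by (auto simp: rp2_complex_def)
  then show "s \<subseteq> {..<6}" "card s \<le> 3"
    using rp2_triangle_subset[OF F(1)] card_rp2_triangle[OF F(1)]
    by (blast, metis card_mono finite_lessThan finite_subset)
  show "s \<noteq> {}"
    using assms by (simp add: rp2_complex_def)
qed

lemma card_3_rp2_complex_iff: "s \<in> rp2_complex \<and> card s = 3 \<longleftrightarrow> s \<in> rp2_triangles"
proof
  assume s: "s \<in> rp2_complex \<and> card s = 3"
  then obtain F where F: "F \<in> rp2_triangles" "s \<subseteq> F"
    by (auto simp: rp2_complex_def)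
  then have "s = F"
    using s card_rp2_triangle[OF F(1)] rp2_triangle_subset[OF F(1)]
    by (metis card_subset_eq finite_lessThan finite_subset)
  with F show "s \<in> rp2_triangles"
    by simp
next
  assume "s \<in> rp2_triangles"
  then show "s \<in> rp2_complex \<and> card s = 3"
    using card_rp2_triangle[of s] by (force simp: rp2_complex_def)
qed

text \<open>The case \<open>i = j\<close> gives the vertices.\<close>

lemma doubleton_in_rp2_complex:
  assumes "i < 6" "j < 6"
  shows "{i, j} \<in> rp2_complex"
proof -
  have "i \<in> {0,1,2,3,4,5}" "j \<in> {0,1,2,3,4,5}"
    using assms by auto
  then show ?thesis
    unfolding rp2_complex_def rp2_triangles_def by (elim insertE emptyE; simp)
qed

theorem triangulation_rp2_complex: "triangulation_of_projective_plane rp2_complex"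
proof -
  have "abstract_simplicial_complex rp2_complex"
    unfolding abstract_simplicial_complex_def
  proof (intro conjI ballI allI impI)
    have "rp2_complex \<subseteq> Pow {..<6}"
      using rp2_complexD(2) by blast
    then show "finite rp2_complex"
      by (simp add: finite_subset)
    show "finite s" if "s \<in> rp2_complex" for s
      using rp2_complexD(2)[OF that] by (simp add: finite_subset)
    show "{} \<notin> rp2_complex"
      by (simp add: rp2_complex_def)
    show "t \<in> rp2_complex" if st: "s \<in> rp2_complex" "t \<subseteq> s \<and> t \<noteq> {}" for s t
    proof -
      obtain F where "F \<in> rp2_triangles" "s \<subseteq> F"
        using st(1) by (auto simp: rp2_complex_def)
      with st(2) have "F \<in> rp2_triangles" "t \<subseteq> F" "t \<noteq> {}"
        by auto
      then show ?thesis
        by (auto simp: rp2_complex_def)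
    qed
  qed
  moreover have "two_dimensional rp2_complex"
  proof -
    have "{0, 1, 2} \<in> rp2_triangles"
      by (simp add: rp2_triangles_def)
    then show ?thesis
      unfolding two_dimensional_def using card_3_rp2_complex_iff rp2_complexD(3) by blast
  qed
  moreover have "underlying_space rp2_complex = fan_barycentric ` sphere 0 1"
  proof
    show "underlying_space rp2_complex \<subseteq> fan_barycentric ` sphere 0 1"
      using underlying_space_subset_fan_barycentric by blast
    have "X \<noteq> 0" if "X \<in> sphere 0 1" for X :: "real^3"
      using that by auto
    then show "fan_barycentric ` sphere 0 1 \<subseteq> underlying_space rp2_complex"
      using fan_barycentric_in_underlying_space by blast
  qed
  moreover have "top_of_set (fan_barycentric ` sphere 0 1) homeomorphic_space projective_plane"
    using continuous_on_fan_barycentric fan_barycentric_eq_iff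
    by (rule homeomorphic_space_projective_plane)
  ultimately show ?thesis
    by (simp add: triangulation_of_projective_plane_def)
qed


section \<open>Six points in four-space\<close>

definition point :: "nat \<Rightarrow> real^4" where
  "point i =
     (if i = 0 then 0 else if i = 1 then axis 1 1 else if i = 2 then axis 2 1
      else if i = 3 then axis 3 1 else if i = 4 then axis 4 1 else (\<chi> k. - 1))"

lemma affine_dependence_constant:
  assumes dep: "(\<Sum>i<6. c i *\<^sub>R point i) = 0" and i: "i \<in> {1..5}"
  shows "c i = c 5"
proof -
  have "c 1 - c 5 = 0 \<and> c 2 - c 5 = 0 \<and> c 3 - c 5 = 0 \<and> c 4 - c 5 = 0"
    using dep by (simp add: lessThan_6 point_def vec_eq_iff forall_4 axis_def)
  moreover have "i = 1 \<or> i = 2 \<or> i = 3 \<or> i = 4 \<or> i = 5"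
    using i by auto
  ultimately show ?thesis
    by auto
qed

lemma affine_dependence_trivial:
  assumes sum: "(\<Sum>i<6. c i) = 0" and dep: "(\<Sum>i<6. c i *\<^sub>R point i) = 0"
    and k: "k \<in> {1..5}" "c k = 0" and i: "i < 6"
  shows "c i = 0"
proof -
  have outer: "c j = 0" if "j \<in> {1..5}" for j
    using affine_dependence_constant[OF dep that] affine_dependence_constant[OF dep k(1)] k(2) by simp
  then have "c 0 = 0"
    using sum by (simp add: lessThan_6)
  with outer[of i] i show ?thesis
    by (cases "i = 0") auto
qed

text \<open>The difference of the coordinates is an affine dependence, so it has the same value at all five
  outer points. If this value were not zero, then one of the two coordinate functions would be
  positive at five points, but it is supported on three.\<close>

lemma barycentric_coordinates_unique:
  assumes nonneg: "\<And>i. 0 \<le> a i" "\<And>i. 0 \<le> b i"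
    and supp: "\<And>i. i \<notin> s \<Longrightarrow> a i = 0" "\<And>i. i \<notin> t \<Longrightarrow> b i = 0"
    and s: "finite s" "card s \<le> 3" and t: "finite t" "card t \<le> 3"
    and sum: "(\<Sum>i<6. a i) = (\<Sum>i<6. b i)"
    and eq: "(\<Sum>i<6. a i *\<^sub>R point i) = (\<Sum>i<6. b i *\<^sub>R point i)"
    and i: "i < 6"
  shows "a i = b i"
proof -
  define c where "c = (\<lambda>i. a i - b i)"
  have dep: "(\<Sum>i<6. c i) = 0" "(\<Sum>i<6. c i *\<^sub>R point i) = 0"
    using sum eq by (simp_all add: c_def sum_subtractf scaleR_diff_left)
  note outer = affine_dependence_constant[OF dep(2)]
  have large: "\<not> {1..5::nat} \<subseteq> r" if "finite r" "card r \<le> 3" for r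
    using card_mono[OF that(1), of "{1..5}"] that(2) by auto
  have "c 5 = 0"
  proof (rule ccontr)
    assume "c 5 \<noteq> 0"
    then consider "c 5 > 0" | "c 5 < 0"
      by linarith
    then show False
    proof cases
      case 1
      have "j \<in> s" if "j \<in> {1..5}" for j
        using outer[OF that] 1 nonneg(2)[of j] supp(1)[of j] by (force simp: c_def)
      then show False
        using large[OF s] by blast
    next
      case 2
      have "j \<in> t" if "j \<in> {1..5}" for j
        using outer[OF that] 2 nonneg(1)[of j] supp(2)[of j] by (force simp: c_def)
      then show False
        using large[OF t] by blast
    qed
  qed
  then have "c i = 0"
    using affine_dependence_trivial[OF dep, of 5] i by simp
  then show ?thesis
    by (simp add: c_def)
qed

lemma inj_on_point: "inj_on point {..<6}"
proof (rule inj_onI)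
  fix i j :: nat
  assume i: "i \<in> {..<6}" and j: "j \<in> {..<6}" and eq: "point i = point j"
  define d where "d = (\<lambda>i k :: nat. if k = i then 1 else 0 :: real)"
  have sums: "(\<Sum>k<6. d i k) = 1" "(\<Sum>k<6. d i k *\<^sub>R point k) = point i" if "i \<in> {..<6}" for i
    using that by (simp_all add: d_def if_distrib[of "\<lambda>x. x *\<^sub>R _"] cong: if_cong)
  have "d i i = d j i"
  proof (rule barycentric_coordinates_unique[of "d i" "d j" "{i}" "{j}"])
    show "(\<Sum>k<6. d i k) = (\<Sum>k<6. d j k)"
      and "(\<Sum>k<6. d i k *\<^sub>R point k) = (\<Sum>k<6. d j k *\<^sub>R point k)"
      using sums[OF i] sums[OF j] eq by simp_all
  qed (use i in \<open>simp_all add: d_def\<close>)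
  then show "i = j"
    by (simp add: d_def split: if_splits)
qed

lemma convex_hull_points_iff:
  assumes s: "s \<subseteq> {..<6}"
  shows "y \<in> convex hull (point ` s) \<longleftrightarrow>
    (\<exists>a. (\<forall>i. 0 \<le> a i) \<and> (\<forall>i. i \<notin> s \<longrightarrow> a i = 0) \<and> (\<Sum>i<6. a i) = 1 \<and>
      (\<Sum>i<6. a i *\<^sub>R point i) = y)" (is "_ \<longleftrightarrow> ?coords")
proof
  have fin: "finite s" and inj: "inj_on point s"
    using s inj_on_point by (auto intro: finite_subset inj_on_subset)
  assume "y \<in> convex hull (point ` s)"
  then obtain u where u: "\<And>v. v \<in> point ` s \<Longrightarrow> 0 \<le> u v" "sum u (point ` s) = 1"
    "(\<Sum>v\<in>point ` s. u v *\<^sub>R v) = y"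
    using fin by (auto simp: convex_hull_finite)
  let ?a = "\<lambda>i. if i \<in> s then u (point i) else 0"
  have "(\<Sum>i<6. ?a i) = 1"
    using u(2) s sum.mono_neutral_right[of "{..<6}" s ?a] by (simp add: sum.reindex[OF inj])
  moreover have "(\<Sum>i<6. ?a i *\<^sub>R point i) = y"
    using u(3) s sum.mono_neutral_right[of "{..<6}" s "\<lambda>i. ?a i *\<^sub>R point i"]
    by (simp add: sum.reindex[OF inj])
  ultimately show ?coords
    using u(1) by (intro exI[of _ ?a] conjI allI impI) simp_all
next
  assume ?coords
  then obtain a where a: "\<And>i. 0 \<le> a i" "\<And>i. i \<notin> s \<Longrightarrow> a i = 0" "(\<Sum>i<6. a i) = 1"
    "(\<Sum>i<6. a i *\<^sub>R point i) = y"
    by blast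
  have "sum a s = 1" "(\<Sum>i\<in>s. a i *\<^sub>R point i) = y"
    using a s sum.mono_neutral_right[of "{..<6}" s a]
      sum.mono_neutral_right[of "{..<6}" s "\<lambda>i. a i *\<^sub>R point i"] by auto
  moreover have "(\<Sum>i\<in>s. a i *\<^sub>R point i) \<in> convex hull (point ` s)"
  proof (rule convex_sum)
    show "finite s"
      using s by (rule finite_subset) simp
    show "point i \<in> convex hull (point ` s)" if "i \<in> s" for i
      using that by (intro hull_inc imageI)
  qed (use a(1) \<open>sum a s = 1\<close> in simp_all)
  ultimately show "y \<in> convex hull (point ` s)"
    by simp
qed

lemma convex_hull_points_Int:
  assumes s: "s \<subseteq> {..<6}" "card s \<le> 3" and t: "t \<subseteq> {..<6}" "card t \<le> 3"
  shows "convex hull (point ` s) \<inter> convex hull (point ` t) = convex hull (point ` (s \<inter> t))"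
proof
  show "convex hull (point ` (s \<inter> t)) \<subseteq> convex hull (point ` s) \<inter> convex hull (point ` t)"
    by (intro Int_greatest hull_mono image_mono Int_lower1 Int_lower2)
  show "convex hull (point ` s) \<inter> convex hull (point ` t) \<subseteq> convex hull (point ` (s \<inter> t))"
  proof
    fix y
    assume y: "y \<in> convex hull (point ` s) \<inter> convex hull (point ` t)"
    obtain a where a: "\<And>i. 0 \<le> a i" "\<And>i. i \<notin> s \<Longrightarrow> a i = 0" "(\<Sum>i<6. a i) = 1"
      "(\<Sum>i<6. a i *\<^sub>R point i) = y"
      using IntD1[OF y] unfolding convex_hull_points_iff[OF s(1)] by blast
    obtain b where b: "\<And>i. 0 \<le> b i" "\<And>i. i \<notin> t \<Longrightarrow> b i = 0" "(\<Sum>i<6. b i) = 1"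
      "(\<Sum>i<6. b i *\<^sub>R point i) = y"
      using IntD2[OF y] unfolding convex_hull_points_iff[OF t(1)] by blast
    have fin: "finite s" "finite t"
      using s(1) t(1) by (auto intro: finite_subset)
    have "a i = b i" if "i < 6" for i
      using that a(3,4) b(3,4)
      by (intro barycentric_coordinates_unique[OF a(1) b(1) a(2) b(2) fin(1) s(2) fin(2) t(2)])
        simp_all
    then have zero: "a i = 0" if "i \<notin> s \<inter> t" for i
      using that a(2)[of i] b(2)[of i] s(1) by (cases "i < 6") auto
    have "s \<inter> t \<subseteq> {..<6}"
      using s(1) by blast
    then show "y \<in> convex hull (point ` (s \<inter> t))"
      using a(1,3,4) zero by (auto simp: convex_hull_points_iff intro!: exI[of _ a])
  qed
qed

text \<open>An affine dependence that vanishes at one outer point vanishes everywhere, and three points cannot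
  include all the outer ones.\<close>

lemma affine_independent_points:
  assumes s: "s \<subseteq> {..<6}" "card s \<le> 3"
  shows "\<not> affine_dependent (point ` s)"
proof
  have fin: "finite s" and inj: "inj_on point s"
    using s inj_on_point by (auto intro: finite_subset inj_on_subset)
  assume "affine_dependent (point ` s)"
  then obtain u v where u: "sum u (point ` s) = 0" "(\<Sum>v\<in>point ` s. u v *\<^sub>R v) = 0"
    and v: "v \<in> s" "u (point v) \<noteq> 0"
    using fin by (auto simp: affine_dependent_explicit_finite)
  let ?c = "\<lambda>i. if i \<in> s then u (point i) else 0"
  have "(\<Sum>i<6. ?c i) = 0"
    using u(1) s(1) sum.mono_neutral_right[of "{..<6}" s ?c] by (simp add: sum.reindex[OF inj])
  moreover have "(\<Sum>i<6. ?c i *\<^sub>R point i) = 0"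
    using u(2) s(1) sum.mono_neutral_right[of "{..<6}" s "\<lambda>i. ?c i *\<^sub>R point i"]
    by (simp add: sum.reindex[OF inj])
  moreover obtain k where "k \<in> {1..5}" "k \<notin> s"
    using card_mono[OF fin, of "{1..5}"] s(2) by force
  ultimately have "?c v = 0"
    using affine_dependence_trivial[of ?c k v] v(1) s(1) by auto
  with v show False
    by simp
qed

lemma point_in_convex_hull_iff:
  assumes "i < 6" and s: "s \<subseteq> {..<6}" "card s \<le> 3"
  shows "point i \<in> convex hull (point ` s) \<longleftrightarrow> i \<in> s"
proof
  assume "point i \<in> convex hull (point ` s)"
  then have "point i \<in> convex hull (point ` {i}) \<inter> convex hull (point ` s)"
    by simp
  also have "\<dots> = convex hull (point ` ({i} \<inter> s))"
    using assms by (intro convex_hull_points_Int) simp_all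
  finally show "i \<in> s"
    by (cases "i \<in> s") auto
qed (simp add: hull_inc)

lemma convex_hull_points_eq_iff:
  assumes s: "s \<subseteq> {..<6}" "card s \<le> 3" and t: "t \<subseteq> {..<6}" "card t \<le> 3"
  shows "convex hull (point ` s) = convex hull (point ` t) \<longleftrightarrow> s = t"
proof
  assume eq: "convex hull (point ` s) = convex hull (point ` t)"
  have "i \<in> s \<longleftrightarrow> i \<in> t" if "i < 6" for i
    using point_in_convex_hull_iff[OF that s] point_in_convex_hull_iff[OF that t] eq by simp
  with s(1) t(1) show "s = t"
    by blast
qed simp

lemma simplex_convex_hull_points_iff:
  assumes s: "s \<subseteq> {..<6}" "card s \<le> 3"
  shows "n simplex (convex hull (point ` s)) \<longleftrightarrow> int (card s) = n + 1"
proof -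
  have "inj_on point s"
    using s(1) inj_on_point by (rule inj_on_subset[rotated])
  then have card: "card (point ` s) = card s"
    by (rule card_image)
  have indep: "\<not> affine_dependent (point ` s)"
    using affine_independent_points[OF s] .
  show ?thesis
  proof
    assume "n simplex (convex hull (point ` s))"
    then show "int (card s) = n + 1"
      using aff_dim_simplex aff_dim_affine_independent[OF indep] card
      by (metis aff_dim_convex_hull diff_add_cancel)
  next
    assume "int (card s) = n + 1"
    then show "n simplex (convex hull (point ` s))"
      unfolding simplex_def using indep card by auto
  qed
qed


section \<open>The polyhedra and their faces\<close>

definition embedded_rp2 :: "(nat \<Rightarrow> nat) \<Rightarrow> (real^4) set set" where
  "embedded_rp2 \<sigma> = (\<lambda>s. convex hull ((point \<circ> \<sigma>) ` s)) ` rp2_complex"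

lemma mem_embedded_rp2_iff:
  "T \<in> embedded_rp2 \<sigma> \<longleftrightarrow> (\<exists>s\<in>rp2_complex. T = convex hull (point ` \<sigma> ` s))"
  by (auto simp: embedded_rp2_def image_comp)

lemma permuted_simplex:
  assumes "\<sigma> permutes {..<6}" "s \<in> rp2_complex"
  shows "\<sigma> ` s \<subseteq> {..<6}" "card (\<sigma> ` s) = card s" "card (\<sigma> ` s) \<le> 3"
proof -
  show "\<sigma> ` s \<subseteq> {..<6}"
    using rp2_complexD(2)[OF assms(2)] permutes_image[OF assms(1)] by blast
  show "card (\<sigma> ` s) = card s"
    using permutes_inj_on[OF assms(1)] by (rule card_image)
  then show "card (\<sigma> ` s) \<le> 3"
    using rp2_complexD(3)[OF assms(2)] by simp
qed

lemma projective_planar_polyhedron_embedded_rp2: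
  assumes \<sigma>: "\<sigma> permutes {..<6}"
  shows "projective_planar_polyhedron (embedded_rp2 \<sigma>)"
proof -
  have "geometric_realization rp2_complex (point \<circ> \<sigma>)"
    unfolding geometric_realization_def
  proof (intro conjI ballI)
    have "inj_on point (\<sigma> ` \<Union>rp2_complex)"
      using permuted_simplex(1)[OF \<sigma>] by (intro inj_on_subset[OF inj_on_point]) blast
    then show "inj_on (point \<circ> \<sigma>) (\<Union>rp2_complex)"
      using permutes_inj_on[OF \<sigma>] by (simp add: comp_inj_on)
    show "\<not> affine_dependent ((point \<circ> \<sigma>) ` s)" if "s \<in> rp2_complex" for s
      using affine_independent_points[OF permuted_simplex(1,3)[OF \<sigma> that]] by (simp add: image_comp)
    show "convex hull ((point \<circ> \<sigma>) ` s) \<inter> convex hull ((point \<circ> \<sigma>) ` t) =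
        convex hull ((point \<circ> \<sigma>) ` (s \<inter> t))" if "s \<in> rp2_complex" "t \<in> rp2_complex" for s t
      using convex_hull_points_Int[OF permuted_simplex(1,3)[OF \<sigma> that(1)]
          permuted_simplex(1,3)[OF \<sigma> that(2)]]
      by (simp add: image_comp image_Int[OF permutes_inj[OF \<sigma>], symmetric])
  qed
  then show ?thesis
    unfolding projective_planar_polyhedron_def embedded_rp2_def
    using triangulation_rp2_complex by blast
qed

lemma faces_embedded_rp2:
  assumes \<sigma>: "\<sigma> permutes {..<6}"
  shows "faces (embedded_rp2 \<sigma>) = (\<lambda>F. convex hull (point ` \<sigma> ` F)) ` rp2_triangles"
proof -
  have "2 simplex (convex hull (point ` \<sigma> ` s)) \<longleftrightarrow> card s = 3" if "s \<in> rp2_complex" for s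
    using simplex_convex_hull_points_iff[OF permuted_simplex(1,3)[OF \<sigma> that]]
      permuted_simplex(2)[OF \<sigma> that] by auto
  then show ?thesis
    unfolding faces_def mem_embedded_rp2_iff using card_3_rp2_complex_iff by blast
qed

lemma convex_hull_in_faces_iff:
  assumes \<sigma>: "\<sigma> permutes {..<6}" and s: "s \<subseteq> {..<6}" "card s = 3"
  shows "convex hull (point ` s) \<in> faces (embedded_rp2 \<sigma>) \<longleftrightarrow> s \<in> (`) \<sigma> ` rp2_triangles"
proof -
  have "convex hull (point ` s) = convex hull (point ` \<sigma> ` F) \<longleftrightarrow> s = \<sigma> ` F"
    if "F \<in> rp2_triangles" for F
    using convex_hull_points_eq_iff[of s "\<sigma> ` F"] s permuted_simplex[OF \<sigma>, of F]
      that[folded card_3_rp2_complex_iff] by auto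
  then show ?thesis
    unfolding faces_embedded_rp2[OF \<sigma>] by blast
qed

lemma vertices_embedded_rp2:
  assumes \<sigma>: "\<sigma> permutes {..<6}"
  shows "vertices (embedded_rp2 \<sigma>) = point ` {..<6}"
proof
  show "vertices (embedded_rp2 \<sigma>) \<subseteq> point ` {..<6}"
  proof
    fix v
    assume "v \<in> vertices (embedded_rp2 \<sigma>)"
    then obtain s where s: "s \<in> rp2_complex" "{v} = convex hull (point ` \<sigma> ` s)"
      by (auto simp: vertices_def mem_embedded_rp2_iff)
    then obtain i where i: "i \<in> s"
      using rp2_complexD(1) by blast
    then have "point (\<sigma> i) \<in> {v}"
      unfolding s(2) by (simp add: hull_inc)
    with i show "v \<in> point ` {..<6}"
      using permuted_simplex(1)[OF \<sigma> s(1)] by blast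
  qed
  show "point ` {..<6} \<subseteq> vertices (embedded_rp2 \<sigma>)"
  proof (rule image_subsetI)
    fix i :: nat
    assume "i \<in> {..<6}"
    then obtain j where "j < 6" "\<sigma> j = i"
      using permutes_image[OF \<sigma>] by (metis imageE lessThan_iff)
    then show "point i \<in> vertices (embedded_rp2 \<sigma>)"
      using doubleton_in_rp2_complex[of j j]
      by (auto simp: vertices_def mem_embedded_rp2_iff intro!: bexI[of _ "{j}"])
  qed
qed

lemma edges_embedded_rp2:
  assumes \<sigma>: "\<sigma> permutes {..<6}"
  shows "edges (embedded_rp2 \<sigma>) = (\<lambda>s. convex hull (point ` s)) ` {s. s \<subseteq> {..<6} \<and> card s = 2}"
proof -
  have edge: "1 simplex (convex hull (point ` \<sigma> ` s)) \<longleftrightarrow> card (\<sigma> ` s) = 2"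
    if "s \<in> rp2_complex" for s
    using simplex_convex_hull_points_iff[OF permuted_simplex(1,3)[OF \<sigma> that]] by auto
  have preimage: "\<exists>s'\<in>rp2_complex. s = \<sigma> ` s'" if s_sub: "s \<subseteq> {..<6}" and "card s = 2" for s
  proof -
    obtain i j where s: "s = {i, j}"
      using \<open>card s = 2\<close> by (auto simp: card_2_iff)
    then have "i \<in> \<sigma> ` {..<6}" "j \<in> \<sigma> ` {..<6}"
      using s_sub permutes_image[OF \<sigma>] by auto
    then obtain i' j' where "i' < 6" "\<sigma> i' = i" "j' < 6" "\<sigma> j' = j"
      by auto
    then show ?thesis
      using doubleton_in_rp2_complex s by (intro bexI[of _ "{i', j'}"]) auto
  qed
  have pairs: "{s. s \<subseteq> {..<6} \<and> card s = 2} = (`) \<sigma> ` {s \<in> rp2_complex. card (\<sigma> ` s) = 2}"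
    (is "?A = ?B")
  proof (intro equalityI subsetI)
    fix s
    assume "s \<in> ?A"
    then show "s \<in> ?B"
      using preimage[of s] by auto
  next
    fix s
    assume "s \<in> ?B"
    then show "s \<in> ?A"
      using permuted_simplex(1)[OF \<sigma>] by auto
  qed
  have "edges (embedded_rp2 \<sigma>) =
      (\<lambda>s. convex hull (point ` \<sigma> ` s)) ` {s \<in> rp2_complex. card (\<sigma> ` s) = 2}"
    unfolding edges_def mem_embedded_rp2_iff using edge by blast
  then show ?thesis
    by (simp add: pairs image_image)
qed

text \<open>Multiplication by 2 modulo 5 on the labels of the pentagon, where 5 stands for the residue 0.\<close>

definition pentagon_doubling :: "nat \<Rightarrow> nat" where
  "pentagon_doubling i = (if i = 1 then 2 else if i = 2 then 4 else if i = 3 then 1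
     else if i = 4 then 3 else i)"

lemma pentagon_doubling_permutes: "pentagon_doubling permutes {..<6}"
proof (rule bij_imp_permutes)
  have "inj_on pentagon_doubling {..<6}" "pentagon_doubling ` {..<6} = {..<6}"
    unfolding lessThan_6 by (auto simp: inj_on_def pentagon_doubling_def)
  then show "bij_betw pentagon_doubling {..<6} {..<6}"
    by (simp add: bij_betw_def)
qed (auto simp: pentagon_doubling_def)

lemma pentagon_doubling_triangle:
  "F \<in> rp2_triangles \<Longrightarrow> pentagon_doubling ` F \<notin> rp2_triangles"
  unfolding rp2_triangles_def
  by (elim insertE emptyE; hypsubst; simp add: pentagon_doubling_def set_eq_subset)

lemma faces_disjoint:
  assumes \<sigma>: "\<sigma> permutes {..<6}"
  shows "faces (embedded_rp2 \<sigma>) \<inter> faces (embedded_rp2 (\<sigma> \<circ> pentagon_doubling)) = {}"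
proof -
  have \<sigma>': "\<sigma> \<circ> pentagon_doubling permutes {..<6}"
    using permutes_compose[OF pentagon_doubling_permutes \<sigma>] .
  have "convex hull (point ` \<sigma> ` F) \<notin> faces (embedded_rp2 (\<sigma> \<circ> pentagon_doubling))"
    if F: "F \<in> rp2_triangles" for F
  proof
    assume *: "convex hull (point ` \<sigma> ` F) \<in> faces (embedded_rp2 (\<sigma> \<circ> pentagon_doubling))"
    have "\<sigma> ` F \<subseteq> {..<6}" "card (\<sigma> ` F) = 3"
      using permuted_simplex[OF \<sigma>, of F] F card_3_rp2_complex_iff[of F] by auto
    then have "\<sigma> ` F \<in> (`) (\<sigma> \<circ> pentagon_doubling) ` rp2_triangles"
      using * convex_hull_in_faces_iff[OF \<sigma>'] by blast
    then obtain F' where "F' \<in> rp2_triangles" "\<sigma> ` F = \<sigma> ` pentagon_doubling ` F'"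
      unfolding image_comp by (elim imageE) (simp add: image_comp)
    then show False
      using F pentagon_doubling_triangle by (metis inj_image_eq_iff permutes_inj[OF \<sigma>])
  qed
  then show ?thesis
    unfolding faces_embedded_rp2[OF \<sigma>] by blast
qed

text \<open>The triangles at the edge \<open>{0, 2}\<close> have third vertices 1 and 3, those at \<open>{0, 1}\<close> have 2 and 5. As
  the labels 0, 1, 2 stay fixed, the faces reveal the images of 3 and 5, and so that of 4.\<close>

lemma permutation_determined_by_faces:
  assumes \<sigma>: "\<sigma> permutes {3,4,5}" and \<tau>: "\<tau> permutes {3,4,5}"
    and eq: "faces (embedded_rp2 \<sigma>) = faces (embedded_rp2 \<tau>)"
  shows "\<sigma> = \<tau>"
proof -
  have fixed: "\<rho> i = i" if "\<rho> permutes {3,4,5}" "i < 3" for \<rho> and i :: nat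
    using that by (auto simp: permutes_def)
  have permutes_6: "\<rho> permutes {..<6}" if "\<rho> permutes {3,4,5}" for \<rho> :: "nat \<Rightarrow> nat"
    using that by (rule permutes_subset) auto
  have edge: "x = y" if F: "{0, i, y} \<in> rp2_triangles" "\<sigma> y = \<tau> x"
      and only: "\<And>z. {0, i, z} \<in> rp2_triangles \<Longrightarrow> z \<in> {3,4,5} \<Longrightarrow> z = y"
      and i: "i \<in> {1, 2}" and x: "x \<in> {3,4,5}" for i x y
  proof -
    have images: "\<sigma> ` {0, i, y} = {0, i, \<tau> x}" "\<tau> ` {0, i, x} = {0, i, \<tau> x}"
      using F(2) i fixed[OF \<sigma>] fixed[OF \<tau>] by auto
    have "convex hull (point ` \<sigma> ` {0, i, y}) \<in> faces (embedded_rp2 \<tau>)"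
      using F(1) eq faces_embedded_rp2[OF permutes_6[OF \<sigma>]] by blast
    then have "\<sigma> ` {0, i, y} \<in> (`) \<tau> ` rp2_triangles"
      using convex_hull_in_faces_iff[OF permutes_6[OF \<tau>], of "\<sigma> ` {0, i, y}"]
        permuted_simplex[OF permutes_6[OF \<sigma>], of "{0, i, y}"] F(1) card_3_rp2_complex_iff[of "{0, i, y}"]
      by auto
    then obtain F where F': "F \<in> rp2_triangles" "\<sigma> ` {0, i, y} = \<tau> ` F"
      by (elim imageE)
    then have "\<tau> ` F = \<tau> ` {0, i, x}"
      using images by simp
    then have "F = {0, i, x}"
      by (simp only: inj_image_eq_iff[OF permutes_inj[OF \<tau>]])
    then have "{0, i, x} \<in> rp2_triangles"
      using F'(1) by simp
    then show ?thesis
      using only x by blast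
  qed
  have pre: "\<exists>x\<in>{3,4,5}. \<sigma> y = \<tau> x" if "y \<in> {3,4,5}" for y
    using permutes_image[OF \<sigma>] permutes_image[OF \<tau>] that by (metis imageE imageI)
  have "\<sigma> 3 = \<tau> 3"
  proof -
    obtain x where "x \<in> {3,4,5}" "\<sigma> 3 = \<tau> x"
      using pre[of 3] by auto
    moreover from this have "x = 3"
      by (intro edge[of 2 3 x]) (auto simp: rp2_triangles_def set_eq_subset)
    ultimately show ?thesis
      by simp
  qed
  moreover have "\<sigma> 5 = \<tau> 5"
  proof -
    obtain x where "x \<in> {3,4,5}" "\<sigma> 5 = \<tau> x"
      using pre[of 5] by auto
    moreover from this have "x = 5"
      by (intro edge[of 1 5 x]) (auto simp: rp2_triangles_def set_eq_subset)
    ultimately show ?thesis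
      by simp
  qed
  moreover have "\<sigma> 4 = \<tau> 4"
  proof -
    obtain x where x: "x \<in> {3,4,5}" "\<sigma> 4 = \<tau> x"
      using pre[of 4] by auto
    have "\<sigma> 4 \<noteq> \<sigma> 3" "\<sigma> 4 \<noteq> \<sigma> 5"
      using permutes_inj[OF \<sigma>] by (simp_all add: inj_eq)
    with x calculation show ?thesis
      by auto
  qed
  ultimately have "\<sigma> i = \<tau> i" for i
    using permutes_not_in[OF \<sigma>, of i] permutes_not_in[OF \<tau>, of i]
    by (cases "i \<in> {3,4,5}") auto
  then show ?thesis
    by (rule ext)
qed

theorem corollary2:
  shows "\<exists>(\<P> :: (real^4) set set set set) (G :: (real^4) set \<times> (real^4) set set).
    card \<P> = 6 \<and>
    (\<forall>pair\<in>\<P>. \<exists>P Q. pair = {P, Q} \<and> P \<noteq> Q \<and>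
       projective_planar_polyhedron P \<and> projective_planar_polyhedron Q \<and>
       one_skeleton P = G \<and> one_skeleton Q = G \<and>
       faces P \<inter> faces Q = {})"
proof -
  define S where "S = {\<sigma> :: nat \<Rightarrow> nat. \<sigma> permutes {3,4,5}}"
  define mate where "mate \<sigma> = embedded_rp2 (\<sigma> \<circ> pentagon_doubling)" for \<sigma>
  \<comment> \<open>The common 1-skeleton is the complete graph on the six points.\<close>
  define G where "G = (point ` {..<6},
    (\<lambda>s. convex hull (point ` s)) ` {s. s \<subseteq> {..<6::nat} \<and> card s = 2})"
  have perm: "\<sigma> permutes {..<6}" "\<sigma> \<circ> pentagon_doubling permutes {..<6}" if "\<sigma> \<in> S" for \<sigma>
  proof -
    show "\<sigma> permutes {..<6}"
      using that unfolding S_def by (auto intro: permutes_subset)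
    then show "\<sigma> \<circ> pentagon_doubling permutes {..<6}"
      using permutes_compose[OF pentagon_doubling_permutes] by blast
  qed
  have skeleton: "one_skeleton (embedded_rp2 \<sigma>) = G" if "\<sigma> permutes {..<6}" for \<sigma>
    using that by (simp add: one_skeleton_def G_def vertices_embedded_rp2 edges_embedded_rp2)
  \<comment> \<open>The triangle on 0, 1, 2 tells the two members of a pair apart.\<close>
  have base: "convex hull (point ` {0,1,2}) \<in> faces (embedded_rp2 \<sigma>)" if "\<sigma> \<in> S" for \<sigma>
  proof -
    have "\<sigma> ` {0,1,2} = {0,1,2}"
      using that by (simp add: S_def permutes_def)
    moreover have "{0,1,2} \<in> rp2_triangles"
      by (simp add: rp2_triangles_def)
    ultimately show ?thesis
      unfolding faces_embedded_rp2[OF perm(1)[OF that]] by (metis image_eqI)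
  qed
  have disjoint: "faces (embedded_rp2 \<sigma>) \<inter> faces (mate \<sigma>) = {}" if "\<sigma> \<in> S" for \<sigma>
    unfolding mate_def using faces_disjoint[OF perm(1)[OF that]] .
  have "inj_on (\<lambda>\<sigma>. {embedded_rp2 \<sigma>, mate \<sigma>}) S"
  proof (rule inj_onI)
    fix \<sigma> \<tau>
    assume \<sigma>: "\<sigma> \<in> S" and \<tau>: "\<tau> \<in> S"
      and "{embedded_rp2 \<sigma>, mate \<sigma>} = {embedded_rp2 \<tau>, mate \<tau>}"
    then have "embedded_rp2 \<sigma> = embedded_rp2 \<tau> \<or> embedded_rp2 \<sigma> = mate \<tau>"
      by blast
    moreover have "embedded_rp2 \<sigma> \<noteq> mate \<tau>"
      using base[OF \<sigma>] base[OF \<tau>] disjoint[OF \<tau>] by auto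
    ultimately show "\<sigma> = \<tau>"
      using permutation_determined_by_faces \<sigma> \<tau> by (simp add: S_def)
  qed
  moreover have "card S = 6"
    unfolding S_def using card_permutations[of "{3,4,5::nat}" 3] by (simp add: fact_numeral)
  ultimately have card: "card ((\<lambda>\<sigma>. {embedded_rp2 \<sigma>, mate \<sigma>}) ` S) = 6"
    by (simp add: card_image)
  have pair: "embedded_rp2 \<sigma> \<noteq> mate \<sigma> \<and>
      projective_planar_polyhedron (embedded_rp2 \<sigma>) \<and> projective_planar_polyhedron (mate \<sigma>) \<and>
      one_skeleton (embedded_rp2 \<sigma>) = G \<and> one_skeleton (mate \<sigma>) = G \<and>
      faces (embedded_rp2 \<sigma>) \<inter> faces (mate \<sigma>) = {}" if "\<sigma> \<in> S" for \<sigma>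
    using perm[OF that] disjoint[OF that] base[OF that] skeleton
      projective_planar_polyhedron_embedded_rp2
    by (auto simp: mate_def)
  have "\<forall>pair\<in>(\<lambda>\<sigma>. {embedded_rp2 \<sigma>, mate \<sigma>}) ` S. \<exists>P Q. pair = {P, Q} \<and> P \<noteq> Q \<and>
      projective_planar_polyhedron P \<and> projective_planar_polyhedron Q \<and>
      one_skeleton P = G \<and> one_skeleton Q = G \<and> faces P \<inter> faces Q = {}"
  proof (rule ballI)
    fix pr
    assume "pr \<in> (\<lambda>\<sigma>. {embedded_rp2 \<sigma>, mate \<sigma>}) ` S"
    then obtain \<sigma> where "\<sigma> \<in> S" "pr = {embedded_rp2 \<sigma>, mate \<sigma>}"
      by (rule imageE)
    with pair[OF \<open>\<sigma> \<in> S\<close>] show "\<exists>P Q. pr = {P, Q} \<and> P \<noteq> Q \<and>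
        projective_planar_polyhedron P \<and> projective_planar_polyhedron Q \<and>
        one_skeleton P = G \<and> one_skeleton Q = G \<and> faces P \<inter> faces Q = {}"
      by (intro exI[of _ "embedded_rp2 \<sigma>"] exI[of _ "mate \<sigma>"] conjI) simp_all
  qed
  with card show ?thesis
    by (intro exI[of _ "(\<lambda>\<sigma>. {embedded_rp2 \<sigma>, mate \<sigma>}) ` S"] exI[of _ G] conjI)
qed

end
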